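(* Let $L\ge 2$, let $f_\theta = P_L\circ M_{L-1}\circ P_{L-1}\circ\cdots\circ M_1\circ P_1$ be a map of the class described in the context, with polynomial maps $P_\ell:\mathbb{R}^{d_{\ell-1}}\to\mathbb{R}^{d_\ell}$ ($\ell=1,\dots,L$) and rectified monomial maps $M_\ell:\mathbb{R}^{d_\ell}\to\mathbb{R}^{d_\ell}$ with exponents $\alpha_\ell>0$ ($\ell=1,\dots,L-1$). Then the following two statements hold. (1) (Input linear reparameterization.) For any invertible $S_0\in \mathrm{GL}(d_0)$, define $\tilde P_1(z):=P_1(S_0^{-1}z)$ and let $\tilde f := P_L\circ M_{L-1}\circ P_{L-1}\circ\cdots\circ P_2\circ M_1\circ\tilde P_1$. Then $\tilde f(S_0x)=f_\theta(x)$ for all $x$. (2) (Inter-layer permutation/diagonal reparameterization.) For each $\ell=1,\dots,L-1$ let $\Pi_\ell$ be any $d_\ell\times d_\ell$ permutation matrix and let $D_\ell=\mathrm{diag}(d_{\ell,1},\dots,d_{\ell,d_\ell})$ be any diagonal matrix with strictly positive diagonal entries. Define $$\tilde P_1:=(\Pi_1D_1^{1/\alpha_1})\circ P_1,$$ $$\tilde P_\ell:=(\Pi_\ell D_\ell^{1/\alpha_\ell})\circ P_\ell\circ(\Pi_{\ell-1}D_{\ell-1})^{-1},\qquad \ell=2,\dots,L-1,$$ $$\tilde P_L:=P_L\circ(\Pi_{L-1}D_{L-1})^{-1},$$ and let $\tilde f:=\tilde P_L\circ M_{L-1}\circ\tilde P_{L-1}\circ\cdots\circ M_1\circ\tilde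 P_1$, with the maps $M_\ell$ unchanged. Then $\tilde f(x)=f_\theta(x)$ for all $x$.
   Context: Here $x$ ranges over the domain $X\subseteq\mathbb{R}^{d_0}$ of $f_\theta$; the defining formulas make sense on all of $\mathbb{R}^{d_0}$. For $\ell=1,\dots,L$, $P_\ell:\mathbb{R}^{d_{\ell-1}}\to\mathbb{R}^{d_\ell}$ is the polynomial map with components $$[P_\ell(z)]_j=\sum_{k=1}^{K_{\ell,j}}\big((w^{(\ell)}_{j,k})^\top z+b^{(\ell)}_{j,k}\big)^{r^{(\ell)}_{j,k}},\qquad j=1,\dots,d_\ell,$$ where $K_{\ell,j}\ge 1$ are integers, $r^{(\ell)}_{j,k}\in\mathbb{N}_0$, $w^{(\ell)}_{j,k}\in\mathbb{R}^{d_{\ell-1}}$ and $b^{(\ell)}_{j,k}\in\mathbb{R}$. For $\ell=1,\dots,L-1$, $M_\ell:\mathbb{R}^{d_\ell}\to\mathbb{R}^{d_\ell}$ is given componentwise by $[M_\ell(z)]_i=(z_i)_+^{\alpha_\ell}$, where $(u)_+=\max(u,0)$ and $\alpha_\ell>0$. The parameter $\theta$ collects all $w^{(\ell)}_{j,k}$ and $b^{(\ell)}_{j,k}$; the integers $K_{\ell,j}$, the degrees $r^{(\ell)}_{j,k}$ and the exponents $\alpha_\ell$ are fixed. A matrix is identified with the linear map it defines. For a positive diagonal matrix $D=\mathrm{diag}(d_1,\dots,d_n)$ and $\beta\in\mathbb{R}$, $D^\beta:=\mathrm{diag}(d_1^\beta,\dots,d_n^\beta)$. *)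

theory Defs
  imports
    Complex_Main
    "HOL-Combinatorics.Permutations"
    "Jordan_Normal_Form.Gauss_Jordan_Elimination"
begin

(* Layers are numbered 1,...,L as usual; vector components j and summands k are numbered
   from 0, following the convention of the matrix library. The width of layer l is d l,
   and R^(d l) is carrier_vec (d l). *)

definition poly_map ::
  "(nat \<Rightarrow> nat) \<Rightarrow> (nat \<Rightarrow> nat \<Rightarrow> nat) \<Rightarrow> (nat \<Rightarrow> nat \<Rightarrow> nat \<Rightarrow> nat) \<Rightarrow>
   (nat \<Rightarrow> nat \<Rightarrow> nat \<Rightarrow> real vec) \<Rightarrow> (nat \<Rightarrow> nat \<Rightarrow> nat \<Rightarrow> real) \<Rightarrow>
   nat \<Rightarrow> real vec \<Rightarrow> real vec" where
  "poly_map d K r w b l z =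
     vec (d l) (\<lambda>j. \<Sum>k<K l j. (w l j k \<bullet> z + b l j k) ^ r l j k)"

definition rect_monomial :: "(nat \<Rightarrow> real) \<Rightarrow> nat \<Rightarrow> real vec \<Rightarrow> real vec" where
  "rect_monomial \<alpha> l z = map_vec (\<lambda>u. max u 0 powr \<alpha> l) z"

primrec hidden ::
  "(nat \<Rightarrow> 'a \<Rightarrow> 'a) \<Rightarrow> (nat \<Rightarrow> 'a \<Rightarrow> 'a) \<Rightarrow> nat \<Rightarrow> 'a \<Rightarrow> 'a" where
  "hidden P M 0 = id"
| "hidden P M (Suc l) = M (Suc l) \<circ> P (Suc l) \<circ> hidden P M l"

(* P L o M (L - 1) o P (L - 1) o ... o M 1 o P 1, for L >= 1 *)
definition network ::
  "nat \<Rightarrow> (nat \<Rightarrow> 'a \<Rightarrow> 'a) \<Rightarrow> (nat \<Rightarrow> 'a \<Rightarrow> 'a) \<Rightarrow> 'a \<Rightarrow> 'a" where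
  "network L P M = P L \<circ> hidden P M (L - 1)"

(* The library's inverse is an option; its value is only meaningful for invertible A
   (see mat_inv below). *)
definition mat_inv :: "real mat \<Rightarrow> real mat" where
  "mat_inv A = the (mat_inverse A)"

lemma mat_inv:
  assumes A: "A \<in> carrier_mat n n" and inv: "invertible_mat A"
  shows "mat_inv A \<in> carrier_mat n n" "A * mat_inv A = 1\<^sub>m n" "mat_inv A * A = 1\<^sub>m n"
proof -
  from inv obtain B where AB: "A * B = 1\<^sub>m (dim_row A)" and BA: "B * A = 1\<^sub>m (dim_row B)"
    by (auto simp: invertible_mat_def inverts_mat_def)
  have "dim_col B = n"
    using arg_cong[OF AB, of dim_col] A by simp
  moreover have "dim_row B = n"
    using arg_cong[OF BA, of dim_col] A by simp
  ultimately have "B \<in> carrier_mat n n" by auto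
  with A AB BA have "A \<in> Units (ring_mat TYPE(real) n ())"
    by (auto simp: Units_def ring_mat_simps)
  then obtain C where "mat_inverse A = Some C"
    using mat_inverse(1)[OF A, where b = "()"] by (cases "mat_inverse A") auto
  with mat_inverse(2)[OF A this]
  show "mat_inv A \<in> carrier_mat n n" "A * mat_inv A = 1\<^sub>m n" "mat_inv A * A = 1\<^sub>m n"
    by (simp_all add: mat_inv_def)
qed

definition permutation_mat :: "nat \<Rightarrow> real mat \<Rightarrow> bool" where
  "permutation_mat n Q \<longleftrightarrow>
     (\<exists>\<sigma>. \<sigma> permutes {..<n} \<and> Q = mat n n (\<lambda>(i, j). if i = \<sigma> j then 1 else 0))"

definition pos_diagonal_mat :: "nat \<Rightarrow> real mat \<Rightarrow> bool" where
  "pos_diagonal_mat n D \<longleftrightarrow>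
     D \<in> carrier_mat n n \<and> diagonal_mat D \<and> (\<forall>i<n. D $$ (i, i) > 0)"

definition diag_powr :: "real mat \<Rightarrow> real \<Rightarrow> real mat" where
  "diag_powr D \<beta> = mat_diag (dim_row D) (\<lambda>i. D $$ (i, i) powr \<beta>)"

definition input_reparam ::
  "real mat \<Rightarrow> (nat \<Rightarrow> real vec \<Rightarrow> real vec) \<Rightarrow> nat \<Rightarrow> real vec \<Rightarrow> real vec" where
  "input_reparam S P = P(1 := (\<lambda>z. P 1 (mat_inv S *\<^sub>v z)))"

definition layer_reparam ::
  "nat \<Rightarrow> (nat \<Rightarrow> real) \<Rightarrow> (nat \<Rightarrow> real mat) \<Rightarrow> (nat \<Rightarrow> real mat) \<Rightarrow>
   (nat \<Rightarrow> real vec \<Rightarrow> real vec) \<Rightarrow> nat \<Rightarrow> real vec \<Rightarrow> real vec" where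
  "layer_reparam L \<alpha> Q D P l =
    (if l = 1 then
       (*\<^sub>v) (Q 1 * diag_powr (D 1) (1 / \<alpha> 1)) \<circ> P 1
     else if l < L then
       (*\<^sub>v) (Q l * diag_powr (D l) (1 / \<alpha> l)) \<circ> P l \<circ> (*\<^sub>v) (mat_inv (Q (l - 1) * D (l - 1)))
     else
       P L \<circ> (*\<^sub>v) (mat_inv (Q (L - 1) * D (L - 1))))"

end

theory Submission
  imports Defs "Jordan_Normal_Form.Determinant"
begin

text \<open>
  Both parts say that a linear change of coordinates on a layer cancels against its inverse.
  For the input this is immediate. Between layers, the change of coordinates has to pass through
  the nonlinearity, and it does because the rectified monomial is positively homogeneous:
  \<open>max (c * u) 0 powr \<alpha> = c powr \<alpha> * max u 0 powr \<alpha>\<close> for \<open>c \<ge> 0\<close>. As the nonlinearity acts on every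
  coordinate by the same function, it also commutes with permutations of the coordinates. Hence,
  with \<open>E\<^sub>l\<close> the diagonal matrix of the \<open>(1 / \<alpha>\<^sub>l)\<close>-th powers of the entries of \<open>D\<^sub>l\<close>,
  \<open>M\<^sub>l \<circ> (Q\<^sub>l E\<^sub>l) = (Q\<^sub>l D\<^sub>l) \<circ> M\<^sub>l\<close> (\<open>rect_monomial_perm_diag\<close>), and induction
  on the layer shows that the hidden states of the reparameterized network are \<open>Q\<^sub>l D\<^sub>l\<close> times
  the original ones (\<open>hidden_layer_reparam\<close>); the last layer undoes this factor.
\<close>

lemma poly_map_carrier: "poly_map d K r w b l z \<in> carrier_vec (d l)"
  by (simp add: poly_map_def)

lemma hidden_carrier:
  assumes "l \<ge> 1"
  shows "hidden (poly_map d K r w b) (rect_monomial \<alpha>) l x \<in> carrier_vec (d l)"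
  using assms by (cases l) (auto simp: rect_monomial_def poly_map_def)

text \<open>
  A permutation matrix times a diagonal matrix scales the coordinates by the diagonal entries and
  then moves coordinate \<open>j\<close> to \<open>\<sigma> j\<close>.
\<close>

lemma perm_diag_mult_vec:
  fixes f :: "nat \<Rightarrow> real"
  assumes \<sigma>: "\<sigma> permutes {..<n}" and z: "z \<in> carrier_vec n" and j: "j < n"
  shows "((mat n n (\<lambda>(i, j). if i = \<sigma> j then 1 else 0) * mat_diag n f) *\<^sub>v z) $ \<sigma> j = f j * z $ j"
    (is "((?Q * _) *\<^sub>v z) $ _ = _")
proof -
  have \<sigma>_j: "\<sigma> j < n"
    using permutes_in_image[OF \<sigma>, of j] j by simp
  have "((?Q * mat_diag n f) *\<^sub>v z) $ \<sigma> j = (\<Sum>k<n. (if \<sigma> j = \<sigma> k then 1 else 0) * f k * z $ k)"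
    using \<sigma>_j z
    by (simp add: mat_diag_mult_right[where n = n and nr = n] scalar_prod_def atLeast0LessThan)
  also have "\<dots> = (\<Sum>k<n. if k = j then f k * z $ k else 0)"
    by (rule sum.cong) (auto dest: injD[OF permutes_inj[OF \<sigma>]])
  also have "\<dots> = f j * z $ j"
    using j by simp
  finally show ?thesis .
qed

lemma permutation_mat_carrier: "permutation_mat n Q \<Longrightarrow> Q \<in> carrier_mat n n"
  by (auto simp: permutation_mat_def)

lemma pos_diagonal_mat_eq_mat_diag:
  "pos_diagonal_mat n D \<Longrightarrow> D = mat_diag n (\<lambda>i. D $$ (i, i))"
  by (intro eq_matI) (auto simp: pos_diagonal_mat_def diagonal_mat_def mat_diag_def)

lemma perm_diag_carrier:
  assumes "permutation_mat n Q" and "pos_diagonal_mat n D"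
  shows "Q * D \<in> carrier_mat n n"
  using permutation_mat_carrier[OF assms(1)] assms(2) by (auto simp: pos_diagonal_mat_def)

text \<open>The determinant is nonzero because the kernel is trivial.\<close>

lemma perm_diag_invertible:
  assumes Q: "permutation_mat n Q" and D: "pos_diagonal_mat n D"
  shows "invertible_mat (Q * D)"
proof -
  from Q obtain \<sigma> where \<sigma>: "\<sigma> permutes {..<n}"
    and Q_eq: "Q = mat n n (\<lambda>(i, j). if i = \<sigma> j then 1 else 0)"
    by (auto simp: permutation_mat_def)
  note QD = perm_diag_carrier[OF Q D]
  have "det (Q * D) \<noteq> 0"
  proof
    assume "det (Q * D) = 0"
    then obtain v where v: "v \<in> carrier_vec n" "v \<noteq> 0\<^sub>v n" and kernel: "(Q * D) *\<^sub>v v = 0\<^sub>v n"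
      using det_0_iff_vec_prod_zero_field[OF QD] by auto
    have "v $ j = 0" if j: "j < n" for j
    proof -
      have "\<sigma> j < n" using permutes_in_image[OF \<sigma>, of j] j by simp
      moreover have "((Q * D) *\<^sub>v v) $ \<sigma> j = D $$ (j, j) * v $ j"
        using perm_diag_mult_vec[OF \<sigma> v(1) j, of "\<lambda>i. D $$ (i, i)",
          folded pos_diagonal_mat_eq_mat_diag[OF D]]
        by (simp add: Q_eq)
      ultimately have "D $$ (j, j) * v $ j = 0"
        using kernel by simp
      moreover have "D $$ (j, j) > 0" using D j by (simp add: pos_diagonal_mat_def)
      ultimately show ?thesis by simp
    qed
    with v show False by (metis carrier_vecD eq_vecI index_zero_vec)
  qed
  then have "Q * D \<in> Units (ring_mat TYPE(real) n ())"
    by (rule det_non_zero_imp_unit[OF QD])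
  then obtain B where "B \<in> carrier_mat n n" "B * (Q * D) = 1\<^sub>m n" "Q * D * B = 1\<^sub>m n"
    by (auto simp: Units_def ring_mat_simps)
  moreover have "dim_row (Q * D) = n" "dim_col (Q * D) = n"
    using QD by (rule carrier_matD)+
  ultimately show ?thesis
    unfolding invertible_mat_def inverts_mat_def square_mat.simps by (metis carrier_matD(1))
qed

lemma mat_inv_mult_vec_cancel:
  assumes A: "A \<in> carrier_mat n n" and inv: "invertible_mat A" and z: "z \<in> carrier_vec n"
  shows "mat_inv A *\<^sub>v (A *\<^sub>v z) = z"
  using mat_inv[OF A inv] A z by (metis assoc_mult_mat_vec one_mult_mat_vec)

text \<open>Positive homogeneity, with the scaling normalized so that \<open>c\<close> comes out.\<close>

lemma rect_powr_scale:
  fixes a c u :: real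
  assumes "c > 0" "a > 0"
  shows "max (c powr (1 / a) * u) 0 powr a = c * (max u 0 powr a)"
proof -
  have "max (c powr (1 / a) * u) 0 = c powr (1 / a) * max u 0"
    by (simp add: max_mult_distrib_left)
  then show ?thesis using assms by (simp add: powr_mult powr_powr)
qed

lemma rect_monomial_perm_diag:
  assumes Q: "permutation_mat n Q" and D: "pos_diagonal_mat n D"
    and a: "\<alpha> l > 0" and z: "z \<in> carrier_vec n"
  shows "rect_monomial \<alpha> l ((Q * diag_powr D (1 / \<alpha> l)) *\<^sub>v z) = (Q * D) *\<^sub>v rect_monomial \<alpha> l z"
proof -
  from Q obtain \<sigma> where \<sigma>: "\<sigma> permutes {..<n}"
    and Q_eq: "Q = mat n n (\<lambda>(i, j). if i = \<sigma> j then 1 else 0)"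
    by (auto simp: permutation_mat_def)
  have Qc: "Q \<in> carrier_mat n n" and dim_D: "dim_row D = n" "dim_col D = n"
    using permutation_mat_carrier[OF Q] D by (auto simp: pos_diagonal_mat_def)
  have Mz: "rect_monomial \<alpha> l z \<in> carrier_vec n"
    using z by (simp add: rect_monomial_def)
  show ?thesis
  proof (rule eq_vecI)
    fix i assume "i < dim_vec ((Q * D) *\<^sub>v rect_monomial \<alpha> l z)"
    then have "i < n" using Qc by simp
    then obtain j where j: "j < n" and i: "i = \<sigma> j"
      using permutes_image[OF \<sigma>] by (metis imageE lessThan_iff)
    have D_j: "D $$ (j, j) > 0" using D j by (simp add: pos_diagonal_mat_def)
    have "rect_monomial \<alpha> l ((Q * diag_powr D (1 / \<alpha> l)) *\<^sub>v z) $ i =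
        max (((Q * diag_powr D (1 / \<alpha> l)) *\<^sub>v z) $ i) 0 powr \<alpha> l"
      using \<open>i < n\<close> Qc by (simp add: rect_monomial_def)
    also have "((Q * diag_powr D (1 / \<alpha> l)) *\<^sub>v z) $ i = D $$ (j, j) powr (1 / \<alpha> l) * z $ j"
      using perm_diag_mult_vec[OF \<sigma> z j] by (simp add: Q_eq diag_powr_def dim_D i)
    also have "max \<dots> 0 powr \<alpha> l = D $$ (j, j) * rect_monomial \<alpha> l z $ j"
      using rect_powr_scale[OF D_j a] z j by (simp add: rect_monomial_def)
    also have "\<dots> = ((Q * D) *\<^sub>v rect_monomial \<alpha> l z) $ i"
      using perm_diag_mult_vec[OF \<sigma> Mz j, of "\<lambda>i. D $$ (i, i)",
          folded pos_diagonal_mat_eq_mat_diag[OF D]]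
      by (simp add: Q_eq i)
    finally show "rect_monomial \<alpha> l ((Q * diag_powr D (1 / \<alpha> l)) *\<^sub>v z) $ i =
        ((Q * D) *\<^sub>v rect_monomial \<alpha> l z) $ i" .
  qed (use Qc in \<open>simp add: rect_monomial_def\<close>)
qed

lemma hidden_input_reparam:
  assumes S: "S \<in> carrier_mat n n" "invertible_mat S" and x: "x \<in> carrier_vec n" and "l \<ge> 1"
  shows "hidden (input_reparam S P) M l (S *\<^sub>v x) = hidden P M l x"
  using \<open>l \<ge> 1\<close>
proof (induction l rule: dec_induct)
  case base
  show ?case by (simp add: input_reparam_def mat_inv_mult_vec_cancel[OF S x])
next
  case (step l)
  then show ?case by (simp add: input_reparam_def)
qed

lemma hidden_layer_reparam:
  fixes d :: "nat \<Rightarrow> nat" and \<alpha> :: "nat \<Rightarrow> real"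
    and K :: "nat \<Rightarrow> nat \<Rightarrow> nat" and r :: "nat \<Rightarrow> nat \<Rightarrow> nat \<Rightarrow> nat"
    and w :: "nat \<Rightarrow> nat \<Rightarrow> nat \<Rightarrow> real vec" and b :: "nat \<Rightarrow> nat \<Rightarrow> nat \<Rightarrow> real"
  defines "P \<equiv> poly_map d K r w b" and "M \<equiv> rect_monomial \<alpha>"
  assumes a: "\<And>l. l \<in> {1..L - 1} \<Longrightarrow> \<alpha> l > 0"
    and QD: "\<And>l. l \<in> {1..L - 1} \<Longrightarrow> permutation_mat (d l) (Q l) \<and> pos_diagonal_mat (d l) (D l)"
    and "l \<ge> 1" "l < L"
  shows "hidden (layer_reparam L \<alpha> Q D P) M l x = (Q l * D l) *\<^sub>v hidden P M l x"
  using \<open>l \<ge> 1\<close> \<open>l < L\<close>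
proof (induction l rule: dec_induct)
  case base
  then show ?case
    using rect_monomial_perm_diag[of "d 1" "Q 1" "D 1" \<alpha> 1 "P 1 x"] QD[of 1] a[of 1]
    by (simp add: layer_reparam_def M_def P_def poly_map_carrier)
next
  case (step l)
  let ?h = "hidden P M l x"
  have l: "l \<in> {1..L - 1}" "Suc l \<in> {1..L - 1}" using step by auto
  have h: "?h \<in> carrier_vec (d l)"
    using step.hyps by (simp add: P_def M_def hidden_carrier)
  have "Q l * D l \<in> carrier_mat (d l) (d l)" "invertible_mat (Q l * D l)"
    using QD[OF l(1)] perm_diag_carrier perm_diag_invertible by auto
  then have "mat_inv (Q l * D l) *\<^sub>v ((Q l * D l) *\<^sub>v ?h) = ?h"
    using h by (rule mat_inv_mult_vec_cancel)
  moreover have "hidden (layer_reparam L \<alpha> Q D P) M l x = (Q l * D l) *\<^sub>v ?h"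
    using step by simp
  moreover have "layer_reparam L \<alpha> Q D P (Suc l) =
      (*\<^sub>v) (Q (Suc l) * diag_powr (D (Suc l)) (1 / \<alpha> (Suc l))) \<circ> P (Suc l) \<circ>
      (*\<^sub>v) (mat_inv (Q l * D l))"
    using step by (simp add: layer_reparam_def)
  ultimately have "hidden (layer_reparam L \<alpha> Q D P) M (Suc l) x =
      M (Suc l) ((Q (Suc l) * diag_powr (D (Suc l)) (1 / \<alpha> (Suc l))) *\<^sub>v P (Suc l) ?h)"
    by simp
  also have "\<dots> = (Q (Suc l) * D (Suc l)) *\<^sub>v M (Suc l) (P (Suc l) ?h)"
    unfolding M_def using QD[OF l(2)] a[OF l(2)]
    by (intro rect_monomial_perm_diag[where n = "d (Suc l)"]) (auto simp: P_def poly_map_carrier)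
  finally show ?case by simp
qed

theorem mainTheorem1:
  fixes L :: nat
    and d :: "nat \<Rightarrow> nat"
    and K :: "nat \<Rightarrow> nat \<Rightarrow> nat"
    and r :: "nat \<Rightarrow> nat \<Rightarrow> nat \<Rightarrow> nat"
    and w :: "nat \<Rightarrow> nat \<Rightarrow> nat \<Rightarrow> real vec"
    and b :: "nat \<Rightarrow> nat \<Rightarrow> nat \<Rightarrow> real"
    and \<alpha> :: "nat \<Rightarrow> real"
    and X :: "real vec set"
  defines "P \<equiv> poly_map d K r w b"
    and "M \<equiv> rect_monomial \<alpha>"
  assumes "L \<ge> 2"
    and "\<And>l j. l \<in> {1..L} \<Longrightarrow> j < d l \<Longrightarrow> K l j \<ge> 1"
    and "\<And>l j k. l \<in> {1..L} \<Longrightarrow> j < d l \<Longrightarrow> k < K l j \<Longrightarrow> w l j k \<in> carrier_vec (d (l - 1))"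
    and "\<And>l. l \<in> {1..L - 1} \<Longrightarrow> \<alpha> l > 0"
    and "X \<subseteq> carrier_vec (d 0)"
  shows "(\<forall>S. S \<in> carrier_mat (d 0) (d 0) \<and> invertible_mat S \<longrightarrow>
            (\<forall>x\<in>X. network L (input_reparam S P) M (S *\<^sub>v x) = network L P M x)) \<and>
         (\<forall>Q D. (\<forall>l\<in>{1..L - 1}. permutation_mat (d l) (Q l) \<and> pos_diagonal_mat (d l) (D l)) \<longrightarrow>
            (\<forall>x\<in>X. network L (layer_reparam L \<alpha> Q D P) M x = network L P M x))"
proof (intro conjI allI impI ballI)
  fix S :: "real mat" and x
  assume "S \<in> carrier_mat (d 0) (d 0) \<and> invertible_mat S" and "x \<in> X"
  then have "hidden (input_reparam S P) M (L - 1) (S *\<^sub>v x) = hidden P M (L - 1) x"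
    using assms by (intro hidden_input_reparam[where n = "d 0"]) auto
  then show "network L (input_reparam S P) M (S *\<^sub>v x) = network L P M x"
    using \<open>L \<ge> 2\<close> by (simp add: network_def input_reparam_def)
next
  fix Q D :: "nat \<Rightarrow> real mat" and x
  assume QD: "\<forall>l\<in>{1..L - 1}. permutation_mat (d l) (Q l) \<and> pos_diagonal_mat (d l) (D l)"
  let ?m = "L - 1"
  have m: "?m \<in> {1..L - 1}" "?m \<ge> 1" using \<open>L \<ge> 2\<close> by auto
  have h: "hidden (layer_reparam L \<alpha> Q D P) M ?m x = (Q ?m * D ?m) *\<^sub>v hidden P M ?m x"
    unfolding P_def M_def using assms QD by (intro hidden_layer_reparam) auto
  have "Q ?m * D ?m \<in> carrier_mat (d ?m) (d ?m)" "invertible_mat (Q ?m * D ?m)"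
    using bspec[OF QD m(1)] perm_diag_carrier perm_diag_invertible by auto
  then have "mat_inv (Q ?m * D ?m) *\<^sub>v ((Q ?m * D ?m) *\<^sub>v hidden P M ?m x) = hidden P M ?m x"
    unfolding P_def M_def using hidden_carrier[OF m(2)] by (rule mat_inv_mult_vec_cancel)
  then show "network L (layer_reparam L \<alpha> Q D P) M x = network L P M x"
    using \<open>L \<ge> 2\<close> h by (simp add: network_def layer_reparam_def)
qed

end
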